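(* Let $K\in\mathbb N$ and let $G:[0,\infty)\to\mathbb R^{K\times K}$ (not assumed to be continuous) be symmetric, nonnegative, nonincreasing, and convex. Then $G$ is positive definite. Moreover, $G$ is strictly positive definite if and only if for each nonzero $x\in\mathbb R^K$ the function $t\mapsto x^\top G(t)x$ is nonconstant on $[0,\infty)$.
   Context: Terminology for $G:[0,\infty)\to\mathbb R^{K\times K}$: $G$ is symmetric if $G(t)^\top=G(t)$ for all $t\ge0$; nonnegative if $x^\top G(t)x\ge0$ for all $x\in\mathbb R^K$, $t\ge 0$; nonincreasing if $t\mapsto x^\top G(t)x$ is nonincreasing on $[0,\infty)$ for every $x\in\mathbb R^K$; convex if $t\mapsto x^\top G(t)x$ is convex on $[0,\infty)$ for every $x\in\mathbb R^K$. Define $\widetilde G:\mathbb R\to\mathbb R^{K\times K}$ by $\widetilde G(t)=G(t)$ for $t>0$, $\widetilde G(0)=\frac12(G(0)^\top+G(0))$, $\widetilde G(t)=G(-t)^\top$ for $t<0$ (so $\widetilde G(t)=G(|t|)$ if $G$ is symmetric). A function $H:\mathbb R\to\mathbb C^{K\times K}$ is a positive definite matrix-valued function if $\sum_{i,j=1}^N z_i^*H(t_i-t_j)z_j\ge0$ for all $N\in\mathbb N$, $t_1,\dots,t_N\in\mathbb R$, $z_1,\dots,z_N\in\mathbb C^K$ (where $^*$ is conjugate transpose; the inequality includes that the sum is real). It is strictly positive definite if, in addition, for pairwise distinct $t_1,\dots,t_N$ equality holds only when $z_1=\dots=z_N=0$. $G$ is called (strictly) positive definite if $\widetilde G$ is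 a (strictly) positive definite matrix-valued function. *)

theory Defs
  imports "HOL-Analysis.Analysis"
begin

text \<open>
  A \<open>K \<times> K\<close> matrix is an element of \<open>real ^ 'k ^ 'k\<close> with \<open>K = CARD('k) \<ge> 1\<close>.
  A function \<open>G\<close> on \<open>[0, \<infinity>)\<close> is a function on all of \<open>real\<close>, none of whose values at
  negative arguments is used by any of the notions below.
\<close>

definition symmetric_fun :: "(real \<Rightarrow> real ^ 'k ^ 'k) \<Rightarrow> bool" where
  "symmetric_fun G \<longleftrightarrow> (\<forall>t\<ge>0. transpose (G t) = G t)"

definition quad_form :: "real ^ 'k ^ 'k \<Rightarrow> real ^ 'k \<Rightarrow> real" where
  "quad_form A x = x \<bullet> (A *v x)"

definition nonnegative_fun :: "(real \<Rightarrow> real ^ 'k ^ 'k) \<Rightarrow> bool" where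
  "nonnegative_fun G \<longleftrightarrow> (\<forall>x. \<forall>t\<ge>0. 0 \<le> quad_form (G t) x)"

definition nonincreasing_fun :: "(real \<Rightarrow> real ^ 'k ^ 'k) \<Rightarrow> bool" where
  "nonincreasing_fun G \<longleftrightarrow> (\<forall>x. antimono_on {0..} (\<lambda>t. quad_form (G t) x))"

definition convex_fun :: "(real \<Rightarrow> real ^ 'k ^ 'k) \<Rightarrow> bool" where
  "convex_fun G \<longleftrightarrow> (\<forall>x. convex_on {0..} (\<lambda>t. quad_form (G t) x))"

definition tilde :: "(real \<Rightarrow> real ^ 'k ^ 'k) \<Rightarrow> real \<Rightarrow> real ^ 'k ^ 'k" where
  "tilde G t =
     (if t > 0 then G t
      else if t = 0 then (1 / 2) *\<^sub>R (transpose (G 0) + G 0)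
      else transpose (G (- t)))"

text \<open>The sesquilinear form \<open>z* A w\<close>, where \<open>z*\<close> is the conjugate transpose of \<open>z\<close>.\<close>

definition sesq_form :: "complex ^ 'k \<Rightarrow> complex ^ 'k ^ 'k \<Rightarrow> complex ^ 'k \<Rightarrow> complex" where
  "sesq_form z A w = (\<Sum>k\<in>UNIV. cnj (z $ k) * (A *v w) $ k)"

definition pd_sum ::
  "(real \<Rightarrow> complex ^ 'k ^ 'k) \<Rightarrow> nat \<Rightarrow> (nat \<Rightarrow> real) \<Rightarrow> (nat \<Rightarrow> complex ^ 'k) \<Rightarrow> complex" where
  "pd_sum H N t z = (\<Sum>i<N. \<Sum>j<N. sesq_form (z i) (H (t i - t j)) (z j))"

definition positive_definite_mvf :: "(real \<Rightarrow> complex ^ 'k ^ 'k) \<Rightarrow> bool" where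
  "positive_definite_mvf H \<longleftrightarrow>
     (\<forall>N t z. pd_sum H N t z \<in> \<real> \<and> 0 \<le> Re (pd_sum H N t z))"

definition strictly_positive_definite_mvf :: "(real \<Rightarrow> complex ^ 'k ^ 'k) \<Rightarrow> bool" where
  "strictly_positive_definite_mvf H \<longleftrightarrow>
     positive_definite_mvf H \<and>
     (\<forall>N t z. inj_on t {..<N} \<longrightarrow> pd_sum H N t z = 0 \<longrightarrow> (\<forall>i<N. z i = 0))"

definition complex_matrix :: "real ^ 'k ^ 'k \<Rightarrow> complex ^ 'k ^ 'k" where
  "complex_matrix A = (\<chi> i j. complex_of_real (A $ i $ j))"

definition positive_definite :: "(real \<Rightarrow> real ^ 'k ^ 'k) \<Rightarrow> bool" where
  "positive_definite G \<longleftrightarrow> positive_definite_mvf (\<lambda>t. complex_matrix (tilde G t))"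

definition strictly_positive_definite :: "(real \<Rightarrow> real ^ 'k ^ 'k) \<Rightarrow> bool" where
  "strictly_positive_definite G \<longleftrightarrow>
     strictly_positive_definite_mvf (\<lambda>t. complex_matrix (tilde G t))"

end

theory Submission
  imports Defs
begin

text \<open>
  The quadratic form of \<open>G\<close> involves \<open>G\<close> only at finitely many distances \<open>\<bar>t i - t j\<bar>\<close>, so \<open>G\<close>
  may be replaced by its piecewise linear interpolation at these points, continued by a constant.
  Convexity and monotonicity turn this into \<open>G s = C + (\<Sum>k. max 0 (d k - s) *\<^sub>R A k)\<close> with positive
  semidefinite \<open>C\<close> and \<open>A k\<close>, and the hat function \<open>max 0 (d - \<bar>s - t\<bar>)\<close> is the integral of the
  product of the indicators of \<open>[s, s + d)\<close> and \<open>[t, t + d)\<close>. For strictness, the interpolation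
  points may include an arbitrary further \<open>s\<close>; if the form vanishes, then near the leftmost \<open>t i\<close>
  with \<open>x i \<noteq> 0\<close> only \<open>x i\<close> contributes to the integrals, so every \<open>A k\<close> with \<open>d k > 0\<close> is degenerate
  at \<open>x i\<close>, and \<open>quad_form (G s) (x i) = quad_form (G 0) (x i)\<close>.
\<close>

section \<open>Algebra of quadratic forms\<close>

lemma quad_form_zero [simp]: "quad_form 0 x = 0"
  by (simp add: quad_form_def)

lemma quad_form_diff: "quad_form (A - B) x = quad_form A x - quad_form B x"
  by (simp add: quad_form_def matrix_vector_mult_diff_rdistrib inner_diff_right)

lemma quad_form_scaleR: "quad_form (c *\<^sub>R A) x = c * quad_form A x"
  by (simp add: quad_form_def scaleR_matrix_vector_assoc [symmetric])

lemma quad_form_add: "quad_form (A + B) x = quad_form A x + quad_form B x"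
  by (simp add: quad_form_def matrix_vector_mult_add_rdistrib inner_add_right)

lemma quad_form_sum: "quad_form (\<Sum>k\<in>S. A k) x = (\<Sum>k\<in>S. quad_form (A k) x)"
  by (induction S rule: infinite_finite_induct) (simp_all add: quad_form_add)

lemma matrix_vector_sum_rdistrib:
  fixes A :: "'b \<Rightarrow> real ^ 'n ^ 'm"
  shows "(\<Sum>k\<in>S. A k) *v x = (\<Sum>k\<in>S. A k *v x)"
  by (induction S rule: infinite_finite_induct) (simp_all add: matrix_vector_mult_add_rdistrib)

lemma quad_form_lincomb:
  "quad_form A (\<Sum>i\<in>I. c i *\<^sub>R x i) =
    (\<Sum>i\<in>I. \<Sum>j\<in>I. c i * c j * (x i \<bullet> (A *v x j)))"
  by (simp add: quad_form_def linear_sum [OF matrix_vector_mul_linear] matrix_vector_mult_scaleR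
      inner_sum_left inner_sum_right sum_distrib_left, subst sum.swap, simp add: mult_ac)

section \<open>Hat functions as positive definite kernels\<close>

lemma integral_indicator_Ico_mult:
  fixes d s t :: real
  assumes "0 \<le> d"
  shows "has_bochner_integral lborel
    (\<lambda>u. indicator {s..<s + d} u * indicator {t..<t + d} u :: real) (max 0 (d - \<bar>s - t\<bar>))"
proof -
  have finite: "emeasure lborel {a..<b} < \<infinity>" for a b :: real
    by (cases "a \<le> b") simp_all
  have eq: "(\<lambda>u. indicator {s..<s + d} u * indicator {t..<t + d} u :: real)
      = indicator {max s t..<min s t + d}"
    by (auto simp: indicator_def fun_eq_iff)
  have "has_bochner_integral lborel (indicator {max s t..<min s t + d} :: real \<Rightarrow> real)
      (measure lborel {max s t..<min s t + d})"
    by (intro has_bochner_integral_real_indicator finite) simp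
  moreover have "measure lborel {max s t..<min s t + d} = max 0 (d - \<bar>s - t\<bar>)"
    by (cases "max s t \<le> min s t + d") (auto simp: max_def min_def abs_if not_le split: if_splits)
  ultimately show ?thesis
    by (simp add: eq)
qed

text \<open>Expanding the form bilinearly leaves, for each pair of indices, a constant times a
  product of two indicators, and that product integrates to a hat function of the distance.\<close>

lemma hat_kernel_integral:
  fixes A :: "real ^ 'k ^ 'k"
  assumes "finite I" and "0 \<le> d"
  shows "has_bochner_integral lborel
    (\<lambda>u. quad_form A (\<Sum>i\<in>I. indicator {t i..<t i + d} u *\<^sub>R x i))
    (\<Sum>i\<in>I. \<Sum>j\<in>I. max 0 (d - \<bar>t i - t j\<bar>) * (x i \<bullet> (A *v x j)))"
  unfolding quad_form_lincomb
  by (intro has_bochner_integral_sum has_bochner_integral_mult_left integral_indicator_Ico_mult assms)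

lemma hat_kernel_nonneg:
  fixes A :: "real ^ 'k ^ 'k"
  assumes "finite I" and "0 \<le> d" and "\<And>y. 0 \<le> quad_form A y"
  shows "0 \<le> (\<Sum>i\<in>I. \<Sum>j\<in>I. max 0 (d - \<bar>t i - t j\<bar>) * (x i \<bullet> (A *v x j)))"
  unfolding has_bochner_integral_integral_eq [OF hat_kernel_integral [OF assms(1,2)], symmetric]
  using assms(3) by simp

text \<open>On the interval \<open>[t i0, t i0 + \<delta>)\<close> only the leftmost indicator is nonzero.\<close>

lemma hat_kernel_lower_bound:
  fixes A :: "real ^ 'k ^ 'k"
  assumes "finite I" and "0 \<le> \<delta>" and "\<delta> \<le> d" and psd: "\<And>y. 0 \<le> quad_form A y"
    and i0: "i0 \<in> I" and gap: "\<And>i. i \<in> I - {i0} \<Longrightarrow> t i0 + \<delta> \<le> t i"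
  shows "\<delta> * quad_form A (x i0)
    \<le> (\<Sum>i\<in>I. \<Sum>j\<in>I. max 0 (d - \<bar>t i - t j\<bar>) * (x i \<bullet> (A *v x j)))"
proof -
  let ?w = "\<lambda>u. \<Sum>i\<in>I. indicator {t i..<t i + d} u *\<^sub>R x i"
  have w: "?w u = x i0" if u: "u \<in> {t i0..<t i0 + \<delta>}" for u
  proof -
    have "?w u = indicator {t i0..<t i0 + d} u *\<^sub>R x i0
        + (\<Sum>i\<in>I - {i0}. indicator {t i..<t i + d} u *\<^sub>R x i)"
      using assms(1) i0 by (rule sum.remove)
    moreover have "(\<Sum>i\<in>I - {i0}. indicator {t i..<t i + d} u *\<^sub>R x i) = 0"
      using gap u by (intro sum.neutral) (force simp: indicator_def)
    moreover have "u \<in> {t i0..<t i0 + d}"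
      using u \<open>\<delta> \<le> d\<close> by auto
    ultimately show ?thesis
      by simp
  qed
  \<comment> \<open>The integrand is bounded below by its constant value on the short interval and
    by 0 elsewhere; integrating this minorant gives the bound.\<close>
  have "has_bochner_integral lborel (\<lambda>u. indicator {t i0..<t i0 + \<delta>} u * quad_form A (x i0))
      (measure lborel {t i0..<t i0 + \<delta>} * quad_form A (x i0))"
    by (intro has_bochner_integral_mult_left has_bochner_integral_real_indicator)
      (use \<open>0 \<le> \<delta>\<close> in auto)
  moreover have "indicator {t i0..<t i0 + \<delta>} u * quad_form A (x i0) \<le> quad_form A (?w u)" for u
    using w [of u] psd by (auto simp: indicator_def)
  moreover have "has_bochner_integral lborel (\<lambda>u. quad_form A (?w u))
      (\<Sum>i\<in>I. \<Sum>j\<in>I. max 0 (d - \<bar>t i - t j\<bar>) * (x i \<bullet> (A *v x j)))"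
    using assms(1-3) by (intro hat_kernel_integral) auto
  ultimately have "measure lborel {t i0..<t i0 + \<delta>} * quad_form A (x i0)
    \<le> (\<Sum>i\<in>I. \<Sum>j\<in>I. max 0 (d - \<bar>t i - t j\<bar>) * (x i \<bullet> (A *v x j)))"
    unfolding has_bochner_integral_iff by (metis (no_types, lifting) integral_mono)
  then show ?thesis
    using \<open>0 \<le> \<delta>\<close> by simp
qed

section \<open>Piecewise linear interpolation by hat functions\<close>

text \<open>Summation by parts: a piecewise linear function with slopes \<open>S\<close> that is constant after
  its last knot is a constant plus hat functions weighted by the slope increments.\<close>

lemma piecewise_linear_hat_sum:
  fixes G S :: "nat \<Rightarrow> 'a::real_vector"
  assumes "j \<le> m" and "S m = 0"
    and step: "\<And>k. k < m \<Longrightarrow> G (Suc k) - G k = (d (Suc k) - d k) *\<^sub>R S k"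
  shows "G j = G m + (\<Sum>k\<in>{j<..m}. (d k - d j) *\<^sub>R (S k - S (k - 1)))"
  using \<open>j \<le> m\<close>
proof (induction rule: inc_induct)
  case base
  then show ?case by simp
next
  case (step n)
  have tel: "(\<Sum>k\<in>{n<..m}. S k - S (k - 1)) = - S n"
    using sum_telescope'' [of n m S] step.hyps \<open>S m = 0\<close>
    by (simp add: atLeastSucAtMost_greaterThanAtMost)
  \<comment> \<open>Distances to \<open>d n\<close> are split at the next knot: the first part is
    the sum of the induction hypothesis, its term for \<open>k = Suc n\<close> being 0, and the
    second part telescopes.\<close>
  have "(\<Sum>k\<in>{n<..m}. (d k - d n) *\<^sub>R (S k - S (k - 1)))
      = (\<Sum>k\<in>{n<..m}. (d k - d (Suc n)) *\<^sub>R (S k - S (k - 1))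
          + (d (Suc n) - d n) *\<^sub>R (S k - S (k - 1)))"
    by (intro sum.cong refl) (simp add: scaleR_left_distrib [symmetric])
  also have "\<dots> = (\<Sum>k\<in>{n<..m}. (d k - d (Suc n)) *\<^sub>R (S k - S (k - 1)))
        + (d (Suc n) - d n) *\<^sub>R (\<Sum>k\<in>{n<..m}. S k - S (k - 1))"
    by (simp add: sum.distrib scaleR_sum_right)
  also have "(\<Sum>k\<in>{n<..m}. (d k - d (Suc n)) *\<^sub>R (S k - S (k - 1)))
      = (\<Sum>k\<in>{Suc n<..m}. (d k - d (Suc n)) *\<^sub>R (S k - S (k - 1)))"
    by (intro sum.mono_neutral_right) (auto simp: not_less le_Suc_eq)
  also have "\<dots> = G (Suc n) - G m"
    using step.IH by simp
  also have "(d (Suc n) - d n) *\<^sub>R (\<Sum>k\<in>{n<..m}. S k - S (k - 1)) = G n - G (Suc n)"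
    using assms(3) [of n] step.hyps tel by (simp add: minus_equation_iff)
  finally show ?case
    by simp
qed

text \<open>The weight \<open>A k\<close> is the increase of slope at the knot \<open>d k\<close>.
  At inner knots its form is nonnegative by convexity; at the last knot the slope rises from a
  nonpositive value to 0 by monotonicity.\<close>

lemma interpolation_hat_sum:
  fixes G :: "real \<Rightarrow> real ^ 'k ^ 'k" and d :: "nat \<Rightarrow> real"
  assumes "nonincreasing_fun G" and "convex_fun G"
    and mono: "strict_mono_on {..m} d" and nonneg: "\<And>k. k \<le> m \<Longrightarrow> 0 \<le> d k"
  obtains A :: "nat \<Rightarrow> real ^ 'k ^ 'k" where "\<And>k y. 0 \<le> quad_form (A k) y"
    and "\<And>s. s \<in> d ` {..m} \<Longrightarrow> G s = G (d m) + (\<Sum>k\<le>m. max 0 (d k - s) *\<^sub>R A k)"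
proof
  \<comment> \<open>The value 0 from index \<open>m\<close> on encodes the constant continuation
    after the last knot.\<close>
  define S where "S k = (if k < m then (1 / (d (Suc k) - d k)) *\<^sub>R (G (d (Suc k)) - G (d k)) else 0)"
    for k
  \<comment> \<open>The smallest knot gets weight 0, since its hat vanishes at every knot.\<close>
  define A where "A k = (if 0 < k \<and> k \<le> m then S k - S (k - 1) else 0)" for k
  have less: "d j < d k" if "j < k" "k \<le> m" for j k
    using mono that by (auto simp: strict_mono_on_def)
  show "0 \<le> quad_form (A k) y" for k y
  proof (cases "0 < k \<and> k \<le> m")
    case True
    then obtain l where l: "k = Suc l" "l < m"
      by (cases k) auto
    let ?q = "\<lambda>t. quad_form (G t) y"
    have S: "quad_form (S i) y = (?q (d (Suc i)) - ?q (d i)) / (d (Suc i) - d i)" if "i < m" for i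
      using that by (simp add: S_def quad_form_scaleR quad_form_diff)
    have "quad_form (S l) y \<le> quad_form (S k) y"
    proof (cases "k < m")
      case True
      \<comment> \<open>The slopes over two neighbouring intervals are compared through the slope of
        the chord over their union.\<close>
      have "convex_on {0..} ?q"
        using assms(2) by (simp add: convex_fun_def)
      then have "(?q (d l) - ?q (d k)) / (d l - d k) \<le> (?q (d l) - ?q (d (Suc k))) / (d l - d (Suc k))"
        "(?q (d l) - ?q (d (Suc k))) / (d l - d (Suc k)) \<le> (?q (d k) - ?q (d (Suc k))) / (d k - d (Suc k))"
        using convex_on_slope_le [of "{0..}" ?q "d l" "d (Suc k)" "d k"] True l
          less [of l k] less [of k "Suc k"] nonneg [of l] nonneg [of "Suc k"] by auto
      then have "(?q (d l) - ?q (d k)) / (d l - d k) \<le> (?q (d k) - ?q (d (Suc k))) / (d k - d (Suc k))"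
        by simp
      then have "(?q (d k) - ?q (d l)) / (d k - d l) \<le> (?q (d (Suc k)) - ?q (d k)) / (d (Suc k) - d k)"
        by (metis minus_diff_eq minus_divide_divide)
      then show ?thesis
        using S l True by simp
    next
      case False
      have "antimono_on {0..} ?q"
        using assms(1) by (simp add: nonincreasing_fun_def)
      then have "?q (d k) \<le> ?q (d l)"
        using less [of l k] l nonneg [of l] nonneg [of k] by (auto simp: monotone_on_def)
      then have "quad_form (S l) y \<le> 0"
        using S [of l] less [of l k] l by (simp add: divide_nonpos_pos)
      then show ?thesis
        using False by (simp add: S_def)
    qed
    then show ?thesis
      using True l by (simp add: A_def quad_form_diff)
  qed (auto simp: A_def)
  fix s assume "s \<in> d ` {..m}"
  then obtain j where j: "j \<le> m" "s = d j"
    by auto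
  have "G (d j) = G (d m) + (\<Sum>k\<in>{j<..m}. (d k - d j) *\<^sub>R (S k - S (k - 1)))"
  proof (rule piecewise_linear_hat_sum [OF j(1)])
    show "G (d (Suc k)) - G (d k) = (d (Suc k) - d k) *\<^sub>R S k" if "k < m" for k
      using that less [of k "Suc k"] by (simp add: S_def)
  qed (simp add: S_def)
  also have "(\<Sum>k\<in>{j<..m}. (d k - d j) *\<^sub>R (S k - S (k - 1)))
      = (\<Sum>k\<le>m. max 0 (d k - s) *\<^sub>R A k)"
  proof (rule sum.mono_neutral_cong_left)
    show "\<forall>k\<in>{..m} - {j<..m}. max 0 (d k - s) *\<^sub>R A k = 0"
    proof
      fix k assume "k \<in> {..m} - {j<..m}"
      then have "d k \<le> d j"
        using less [of k j] j by (cases "k = j") auto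
      then show "max 0 (d k - s) *\<^sub>R A k = 0"
        using j by simp
    qed
    show "(d k - d j) *\<^sub>R (S k - S (k - 1)) = max 0 (d k - s) *\<^sub>R A k" if "k \<in> {j<..m}" for k
      using that less [of j k] j by (simp add: A_def)
  qed auto
  finally show "G s = G (d m) + (\<Sum>k\<le>m. max 0 (d k - s) *\<^sub>R A k)"
    using j by simp
qed

lemma finite_interpolation_hat_sum:
  fixes G :: "real \<Rightarrow> real ^ 'k ^ 'k"
  assumes "nonincreasing_fun G" and "convex_fun G"
    and D: "finite D" "D \<noteq> {}" "D \<subseteq> {0..}"
  obtains m and d :: "nat \<Rightarrow> real" and A :: "nat \<Rightarrow> real ^ 'k ^ 'k"
  where "\<And>k. k \<le> m \<Longrightarrow> 0 \<le> d k" and "\<And>k y. 0 \<le> quad_form (A k) y"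
    and "\<And>s. s \<in> D \<Longrightarrow> G s = G (d m) + (\<Sum>k\<le>m. max 0 (d k - s) *\<^sub>R A k)"
proof -
  define d where "d k = sorted_list_of_set D ! k" for k
  \<comment> \<open>The index of the last knot: \<open>{..m}\<close> enumerates the nonempty set
    \<open>D\<close> in increasing order.\<close>
  define m where "m = card D - 1"
  have m: "Suc m = card D"
    using D by (simp add: m_def card_gt_0_iff)
  have mono: "strict_mono_on {..m} d"
    using m by (auto simp: strict_mono_on_def d_def intro!: sorted_wrt_nth_less
        [OF strict_sorted_list_of_set])
  have im: "d ` {..m} = D"
  proof -
    have "d ` {..m} = (!) (sorted_list_of_set D) ` {..<length (sorted_list_of_set D)}"
      using m by (simp add: d_def lessThan_Suc_atMost [symmetric] image_def)
    also have "\<dots> = set (sorted_list_of_set D)"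
      by (simp add: set_conv_nth image_def Bex_def conj_commute)
    finally show ?thesis
      using D by simp
  qed
  have nn: "0 \<le> d k" if "k \<le> m" for k
    using im D(3) that by auto
  obtain A :: "nat \<Rightarrow> real ^ 'k ^ 'k" where "\<And>k y. 0 \<le> quad_form (A k) y"
    "\<And>s. s \<in> D \<Longrightarrow> G s = G (d m) + (\<Sum>k\<le>m. max 0 (d k - s) *\<^sub>R A k)"
    by (rule interpolation_hat_sum [OF assms(1,2) mono, unfolded im], erule nn) (rule that)
  with nn show thesis
    by (rule that)
qed

section \<open>Positivity and strictness for real vectors\<close>

text \<open>The points in \<open>D\<close> other than the distances \<open>\<bar>t i - t j\<bar>\<close> are used for strictness.\<close>

lemma kernel_sum_decomposition:
  fixes G :: "real \<Rightarrow> real ^ 'k ^ 'k" and x :: "'i \<Rightarrow> real ^ 'k"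
  assumes "nonincreasing_fun G" and "convex_fun G" and "finite I"
    and D: "finite D" "D \<noteq> {}" "D \<subseteq> {0..}" "\<And>i j. i \<in> I \<Longrightarrow> j \<in> I \<Longrightarrow> \<bar>t i - t j\<bar> \<in> D"
  obtains m and d :: "nat \<Rightarrow> real" and A :: "nat \<Rightarrow> real ^ 'k ^ 'k"
  where "\<And>k. k \<le> m \<Longrightarrow> 0 \<le> d k" and "\<And>k y. 0 \<le> quad_form (A k) y"
    and "\<And>s. s \<in> D \<Longrightarrow> G s = G (d m) + (\<Sum>k\<le>m. max 0 (d k - s) *\<^sub>R A k)"
    and "(\<Sum>i\<in>I. \<Sum>j\<in>I. x i \<bullet> (G \<bar>t i - t j\<bar> *v x j)) = quad_form (G (d m)) (\<Sum>i\<in>I. x i)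
      + (\<Sum>k\<le>m. \<Sum>i\<in>I. \<Sum>j\<in>I. max 0 (d k - \<bar>t i - t j\<bar>) * (x i \<bullet> (A k *v x j)))"
proof -
  obtain m and d :: "nat \<Rightarrow> real" and A :: "nat \<Rightarrow> real ^ 'k ^ 'k"
    where d: "\<And>k. k \<le> m \<Longrightarrow> 0 \<le> d k" and A: "\<And>k y. 0 \<le> quad_form (A k) y"
      and G: "\<And>s. s \<in> D \<Longrightarrow> G s = G (d m) + (\<Sum>k\<le>m. max 0 (d k - s) *\<^sub>R A k)"
    by (rule finite_interpolation_hat_sum [OF assms(1,2) D(1-3)]) (rule that)
  \<comment> \<open>All distances lie in \<open>D\<close>, where the interpolation is exact, so it
    may be substituted term by term.\<close>
  have "(\<Sum>i\<in>I. \<Sum>j\<in>I. x i \<bullet> (G \<bar>t i - t j\<bar> *v x j)) = (\<Sum>i\<in>I. \<Sum>j\<in>I. x i \<bullet> (G (d m) *v x j)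
      + (\<Sum>k\<le>m. max 0 (d k - \<bar>t i - t j\<bar>) * (x i \<bullet> (A k *v x j))))"
  proof (intro sum.cong refl)
    fix i j assume "i \<in> I" "j \<in> I"
    then show "x i \<bullet> (G \<bar>t i - t j\<bar> *v x j) = x i \<bullet> (G (d m) *v x j)
      + (\<Sum>k\<le>m. max 0 (d k - \<bar>t i - t j\<bar>) * (x i \<bullet> (A k *v x j)))"
      by (subst G [OF D(4)])
        (simp_all add: matrix_vector_mult_add_rdistrib inner_add_right matrix_vector_sum_rdistrib
          inner_sum_right scaleR_matrix_vector_assoc [symmetric])
  qed
  also have "\<dots> = (\<Sum>i\<in>I. \<Sum>j\<in>I. x i \<bullet> (G (d m) *v x j))
      + (\<Sum>i\<in>I. \<Sum>j\<in>I. \<Sum>k\<le>m. max 0 (d k - \<bar>t i - t j\<bar>) * (x i \<bullet> (A k *v x j)))"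
    by (simp add: sum.distrib)
  also have "(\<Sum>i\<in>I. \<Sum>j\<in>I. x i \<bullet> (G (d m) *v x j)) = quad_form (G (d m)) (\<Sum>i\<in>I. x i)"
    using quad_form_lincomb [of "G (d m)" "\<lambda>_. 1" x I] by simp
  also have "(\<Sum>i\<in>I. \<Sum>j\<in>I. \<Sum>k\<le>m. max 0 (d k - \<bar>t i - t j\<bar>) * (x i \<bullet> (A k *v x j)))
      = (\<Sum>k\<le>m. \<Sum>i\<in>I. \<Sum>j\<in>I. max 0 (d k - \<bar>t i - t j\<bar>) * (x i \<bullet> (A k *v x j)))"
    by (simp only: sum.swap [of _ "{..m}"])
  finally show thesis
    by - (rule that [of m d A, OF d A G])
qed

lemma kernel_sum_nonneg:
  fixes G :: "real \<Rightarrow> real ^ 'k ^ 'k"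
  assumes "nonnegative_fun G" and "nonincreasing_fun G" and "convex_fun G" and "finite I"
  shows "0 \<le> (\<Sum>i\<in>I. \<Sum>j\<in>I. x i \<bullet> (G \<bar>t i - t j\<bar> *v x j))"
proof -
  \<comment> \<open>The point 0 keeps the set of knots nonempty even for empty
    \<open>I\<close>.\<close>
  let ?D = "insert 0 ((\<lambda>(i, j). \<bar>t i - t j\<bar>) ` (I \<times> I))"
  obtain m and d :: "nat \<Rightarrow> real" and A :: "nat \<Rightarrow> real ^ 'k ^ 'k"
    where "\<And>k. k \<le> m \<Longrightarrow> 0 \<le> d k" and "\<And>k y. 0 \<le> quad_form (A k) y"
      and "(\<Sum>i\<in>I. \<Sum>j\<in>I. x i \<bullet> (G \<bar>t i - t j\<bar> *v x j)) = quad_form (G (d m)) (\<Sum>i\<in>I. x i)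
      + (\<Sum>k\<le>m. \<Sum>i\<in>I. \<Sum>j\<in>I. max 0 (d k - \<bar>t i - t j\<bar>) * (x i \<bullet> (A k *v x j)))"
    by (rule kernel_sum_decomposition [OF assms(2-4), of ?D t x]) (use assms(4) in auto)
  then show ?thesis
    using assms(1) by (auto simp: nonnegative_fun_def
        intro!: add_nonneg_nonneg sum_nonneg [of "{..m}"] hat_kernel_nonneg [OF assms(4)])
qed

lemma kernel_sum_eq_0D:
  fixes G :: "real \<Rightarrow> real ^ 'k ^ 'k" and t :: "'i \<Rightarrow> real"
  assumes "nonnegative_fun G" and "nonincreasing_fun G" and "convex_fun G" and fin: "finite I"
    and inj: "inj_on t I" and nonconst: "\<And>y. y \<noteq> 0 \<Longrightarrow> \<not> (\<lambda>s. quad_form (G s) y) constant_on {0..}"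
    and zero: "(\<Sum>i\<in>I. \<Sum>j\<in>I. x i \<bullet> (G \<bar>t i - t j\<bar> *v x j)) = 0" and i: "i \<in> I"
  shows "x i = 0"
proof (rule ccontr)
  assume "x i \<noteq> 0"
  \<comment> \<open>Dropping the zero vectors ensures that the leftmost remaining point carries a
    nonzero vector.\<close>
  define J where "J = {i \<in> I. x i \<noteq> 0}"
  have J: "finite J" "J \<noteq> {}" "J \<subseteq> I"
    using fin i \<open>x i \<noteq> 0\<close> by (auto simp: J_def)
  have zeroJ: "(\<Sum>i\<in>J. \<Sum>j\<in>J. x i \<bullet> (G \<bar>t i - t j\<bar> *v x j)) = 0"
  proof -
    have "(\<Sum>j\<in>J. x i \<bullet> (G \<bar>t i - t j\<bar> *v x j)) = (\<Sum>j\<in>I. x i \<bullet> (G \<bar>t i - t j\<bar> *v x j))" for i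
      using fin by (intro sum.mono_neutral_left) (auto simp: J_def)
    then have "(\<Sum>i\<in>J. \<Sum>j\<in>J. x i \<bullet> (G \<bar>t i - t j\<bar> *v x j))
        = (\<Sum>i\<in>J. \<Sum>j\<in>I. x i \<bullet> (G \<bar>t i - t j\<bar> *v x j))"
      by simp
    also have "\<dots> = (\<Sum>i\<in>I. \<Sum>j\<in>I. x i \<bullet> (G \<bar>t i - t j\<bar> *v x j))"
      using fin by (intro sum.mono_neutral_left) (auto simp: J_def)
    finally show ?thesis
      using zero by simp
  qed
  define i0 where "i0 = arg_min_on t J"
  have i0: "i0 \<in> J" "\<And>j. j \<in> J \<Longrightarrow> t i0 \<le> t j"
    using arg_min_if_finite [OF J(1,2), of t] by (auto simp: i0_def not_less)
  \<comment> \<open>The distance from the leftmost point to the next one, capped at 1 so that the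
    minimum also exists when \<open>J\<close> is a singleton.\<close>
  define \<gamma> where "\<gamma> = Min (insert 1 ((\<lambda>j. t j - t i0) ` (J - {i0})))"
  have "t i0 < t j" if "j \<in> J - {i0}" for j
    using that i0 inj J by (metis Diff_iff inj_on_contraD less_eq_real_def singletonI subsetD)
  then have "\<gamma> > 0"
    using J by (auto simp: \<gamma>_def)
  have gap: "t i0 + \<gamma> \<le> t j" if "j \<in> J - {i0}" for j
  proof -
    have "\<gamma> \<le> t j - t i0"
      unfolding \<gamma>_def using that J by (intro Min_le) auto
    then show ?thesis by simp
  qed
  have "quad_form (G s) (x i0) = quad_form (G 0) (x i0)" if s: "s \<ge> 0" for s
  proof -
    \<comment> \<open>The knots 0 and \<open>s\<close> make the same decomposition valid for both
      \<open>G 0\<close> and \<open>G s\<close>, which are to be compared.\<close>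
    let ?D = "insert 0 (insert s ((\<lambda>(i, j). \<bar>t i - t j\<bar>) ` (J \<times> J)))"
    have D: "finite ?D" "?D \<noteq> {}" "?D \<subseteq> {0..}"
      using J(1) s by auto
    have dist: "\<bar>t i - t j\<bar> \<in> ?D" if "i \<in> J" "j \<in> J" for i j
      using that by auto
    let ?hat = "\<lambda>d A. \<Sum>i\<in>J. \<Sum>j\<in>J. max 0 (d - \<bar>t i - t j\<bar>) * (x i \<bullet> (A *v x j))"
    obtain m and d :: "nat \<Rightarrow> real" and A :: "nat \<Rightarrow> real ^ 'k ^ 'k"
      where d: "\<And>k. k \<le> m \<Longrightarrow> 0 \<le> d k" and A: "\<And>k y. 0 \<le> quad_form (A k) y"
        and G: "\<And>s. s \<in> ?D \<Longrightarrow> G s = G (d m) + (\<Sum>k\<le>m. max 0 (d k - s) *\<^sub>R A k)"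
        and eq: "(\<Sum>i\<in>J. \<Sum>j\<in>J. x i \<bullet> (G \<bar>t i - t j\<bar> *v x j))
          = quad_form (G (d m)) (\<Sum>i\<in>J. x i) + (\<Sum>k\<le>m. ?hat (d k) (A k))"
      by (rule kernel_sum_decomposition [OF assms(2,3) J(1) D], erule (1) dist) (rule that)
    have hat_nonneg: "0 \<le> ?hat (d k) (A k)" if "k \<le> m" for k
      by (rule hat_kernel_nonneg [OF J(1) d [OF that] A])
    have "0 \<le> quad_form (G (d m)) (\<Sum>i\<in>J. x i)"
      using assms(1) d by (simp add: nonnegative_fun_def)
    moreover have "0 \<le> (\<Sum>k\<le>m. ?hat (d k) (A k))"
      by (rule sum_nonneg, rule hat_nonneg) simp
    ultimately have "(\<Sum>k\<le>m. ?hat (d k) (A k)) = 0"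
      using eq zeroJ by linarith
    then have hat0: "?hat (d k) (A k) = 0" if "k \<le> m" for k
      using hat_nonneg that sum_nonneg_eq_0_iff [of "{..m}" "\<lambda>k. ?hat (d k) (A k)"] by simp
    have q0: "d k = 0 \<or> quad_form (A k) (x i0) = 0" if "k \<le> m" for k
    proof -
      \<comment> \<open>This length respects both the gap and the width of the hat, and it is
        positive unless \<open>d k = 0\<close>.\<close>
      have "min \<gamma> (d k) * quad_form (A k) (x i0) \<le> 0"
        using hat_kernel_lower_bound [OF J(1) _ _ A i0(1), of "min \<gamma> (d k)" "d k" t k x]
          hat0 [OF that] gap \<open>\<gamma> > 0\<close> d [OF that] by force
      then show ?thesis
        using A [of k "x i0"] \<open>\<gamma> > 0\<close> d [OF that] by (auto simp: mult_le_0_iff)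
    qed
    have "quad_form (G r) (x i0) = quad_form (G (d m)) (x i0)" if "r \<in> ?D" "r \<ge> 0" for r
    proof -
      have "(\<Sum>k\<le>m. max 0 (d k - r) * quad_form (A k) (x i0)) = 0"
        using q0 \<open>r \<ge> 0\<close> by (intro sum.neutral) force
      then show ?thesis
        by (subst G [OF \<open>r \<in> ?D\<close>]) (simp add: quad_form_add quad_form_sum quad_form_scaleR)
    qed
    from this [of s] this [of 0] s show ?thesis
      by simp
  qed
  then have "(\<lambda>s. quad_form (G s) (x i0)) constant_on {0..}"
    unfolding constant_on_def by blast
  with nonconst i0 show False
    by (auto simp: J_def)
qed

section \<open>Reduction from complex to real vectors\<close>

lemma tilde_eq_abs:
  assumes "symmetric_fun G"
  shows "tilde G t = G \<bar>t\<bar>"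
  using assms by (auto simp: tilde_def symmetric_fun_def scaleR_2 [symmetric])

text \<open>For a real matrix the real part has no mixed terms, so positivity splits into one real
  sum for the real parts and one for the imaginary parts.\<close>

lemma sesq_form_complex_matrix:
  "Re (sesq_form z (complex_matrix A) w)
    = (\<chi> k. Re (z $ k)) \<bullet> (A *v (\<chi> k. Re (w $ k))) + (\<chi> k. Im (z $ k)) \<bullet> (A *v (\<chi> k. Im (w $ k)))"
  "Im (sesq_form z (complex_matrix A) w)
    = (\<chi> k. Re (z $ k)) \<bullet> (A *v (\<chi> k. Im (w $ k))) - (\<chi> k. Im (z $ k)) \<bullet> (A *v (\<chi> k. Re (w $ k)))"
  by (simp_all add: sesq_form_def complex_matrix_def matrix_vector_mult_def inner_vec_def
      sum.distrib sum_subtractf)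

lemma Re_pd_sum:
  assumes "symmetric_fun G"
  shows "Re (pd_sum (\<lambda>t. complex_matrix (tilde G t)) N t z)
    = (\<Sum>i<N. \<Sum>j<N. (\<chi> k. Re (z i $ k)) \<bullet> (G \<bar>t i - t j\<bar> *v (\<chi> k. Re (z j $ k))))
    + (\<Sum>i<N. \<Sum>j<N. (\<chi> k. Im (z i $ k)) \<bullet> (G \<bar>t i - t j\<bar> *v (\<chi> k. Im (z j $ k))))"
  by (simp add: pd_sum_def sesq_form_complex_matrix tilde_eq_abs [OF assms] sum.distrib)

text \<open>Exchanging \<open>i\<close> and \<open>j\<close> and using the symmetry of
  \<open>G\<close> turns one of the two mixed sums into the other, so they cancel.\<close>

lemma Im_pd_sum:
  assumes "symmetric_fun G"
  shows "Im (pd_sum (\<lambda>t. complex_matrix (tilde G t)) N t z) = 0"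
proof -
  have sym: "x \<bullet> (G \<bar>a\<bar> *v y) = y \<bullet> (G \<bar>a\<bar> *v x)" for a x y
    using assms dot_lmul_matrix [of x "G \<bar>a\<bar>" y]
    by (metis abs_ge_zero inner_commute symmetric_fun_def transpose_matrix_vector)
  have "(\<Sum>i<N. \<Sum>j<N. (\<chi> k. Re (z i $ k)) \<bullet> (G \<bar>t i - t j\<bar> *v (\<chi> k. Im (z j $ k))))
      = (\<Sum>i<N. \<Sum>j<N. (\<chi> k. Im (z i $ k)) \<bullet> (G \<bar>t i - t j\<bar> *v (\<chi> k. Re (z j $ k))))"
    by (subst sum.swap) (simp add: sym abs_minus_commute)
  then show ?thesis
    by (simp add: pd_sum_def sesq_form_complex_matrix tilde_eq_abs [OF assms] sum_subtractf)
qed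

theorem theorem2p15:
  fixes G :: "real \<Rightarrow> real ^ 'k ^ 'k"
  assumes "symmetric_fun G"
    and "nonnegative_fun G"
    and "nonincreasing_fun G"
    and "convex_fun G"
  shows "positive_definite G \<and>
    (strictly_positive_definite G \<longleftrightarrow>
      (\<forall>x. x \<noteq> 0 \<longrightarrow> \<not> (\<lambda>t. quad_form (G t) x) constant_on {0..}))"
proof -
  let ?H = "\<lambda>t. complex_matrix (tilde G t)"
  let ?re = "\<lambda>z::complex ^ 'k. \<chi> k. Re (z $ k)"
  let ?im = "\<lambda>z::complex ^ 'k. \<chi> k. Im (z $ k)"
  note nonneg = kernel_sum_nonneg [OF assms(2-4) finite_lessThan]
  have pd: "positive_definite G"
    unfolding positive_definite_def positive_definite_mvf_def complex_is_Real_iff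
    by (simp add: Im_pd_sum [OF assms(1)] Re_pd_sum [OF assms(1)] nonneg)
  have "\<forall>i<N. z i = 0"
    if nonconst: "\<forall>x. x \<noteq> 0 \<longrightarrow> \<not> (\<lambda>t. quad_form (G t) x) constant_on {0..}"
      and inj: "inj_on t {..<N}" and zero: "pd_sum ?H N t z = 0" for N t z
  proof (intro allI impI)
    fix i assume "i < N"
    have "Re (pd_sum ?H N t z) = 0"
      by (simp add: zero)
    \<comment> \<open>Two nonnegative sums that add up to 0 both vanish.\<close>
    then have "(\<Sum>i<N. \<Sum>j<N. ?re (z i) \<bullet> (G \<bar>t i - t j\<bar> *v ?re (z j))) = 0"
      "(\<Sum>i<N. \<Sum>j<N. ?im (z i) \<bullet> (G \<bar>t i - t j\<bar> *v ?im (z j))) = 0"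
      using nonneg [of "\<lambda>i. ?re (z i)" t N] nonneg [of "\<lambda>i. ?im (z i)" t N]
      unfolding Re_pd_sum [OF assms(1)] by linarith+
    then have "?re (z i) = 0" "?im (z i) = 0"
      using kernel_sum_eq_0D [OF assms(2-4) finite_lessThan inj, of "\<lambda>i. ?re (z i)" i]
        kernel_sum_eq_0D [OF assms(2-4) finite_lessThan inj, of "\<lambda>i. ?im (z i)" i]
        nonconst \<open>i < N\<close> by blast+
    then show "z i = 0"
      by (simp add: vec_eq_iff complex_eq_iff)
  qed
  moreover have False
    if spd: "strictly_positive_definite G" and "x \<noteq> 0"
      and const: "(\<lambda>t. quad_form (G t) x) constant_on {0..}" for x
  proof -
    \<comment> \<open>The vectors \<open>x\<close> and \<open>- x\<close> at the points 0 and 1 give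
      twice the difference of the forms of \<open>G 0\<close> and \<open>G 1\<close> at
      \<open>x\<close>, which is 0 if the form is constant.\<close>
    define t :: "nat \<Rightarrow> real" where "t i = real i" for i
    define z :: "nat \<Rightarrow> complex ^ 'k" where
      "z i = (\<chi> k. complex_of_real ((- 1) ^ i * x $ k))" for i
    obtain c where c: "quad_form (G s) x = c" if "s \<ge> 0" for s
      using const by (auto simp: constant_on_def)
    have re: "?re (z i) = (- 1) ^ i *\<^sub>R x" and im: "?im (z i) = 0" for i
      by (simp_all add: z_def vec_eq_iff)
    have "Re (pd_sum ?H 2 t z) = 0"
      using c [of 0] c [of 1]
      by (simp add: Re_pd_sum [OF assms(1)] re im numeral_2_eq_2 t_def quad_form_def
          linear_neg [OF matrix_vector_mul_linear])
    then have "pd_sum ?H 2 t z = 0"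
      by (simp add: complex_eq_iff Im_pd_sum [OF assms(1)])
    moreover have "inj_on t {..<2}"
      by (simp add: t_def inj_on_def)
    ultimately have "z 0 = 0"
      using spd unfolding strictly_positive_definite_def strictly_positive_definite_mvf_def
      by (metis pos2)
    then show False
      using \<open>x \<noteq> 0\<close> by (simp add: z_def vec_eq_iff)
  qed
  ultimately show ?thesis
    using pd unfolding strictly_positive_definite_def strictly_positive_definite_mvf_def
      positive_definite_def by blast
qed

end
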